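(* For all integers $r\geq 2$ and $d\geq 1$ there exists a triangle-free $d$-degenerate $r$-uniform hypergraph with chromatic number $d+1$.
   Context: A hypergraph $G$ consists of a set $V(G)$ of vertices and a set $E(G)$ of subsets of $V(G)$ called edges; it is $r$-uniform if every edge has exactly $r$ vertices. A hypergraph $H$ is a subhypergraph of $G$ if $V(H)\subseteq V(G)$ and $E(H)\subseteq E(G)$. The degree of a vertex $v$ is the number of edges containing $v$. A hypergraph is $d$-degenerate if every subhypergraph with at least one vertex has a vertex of degree at most $d$. A colouring of $G$ assigns one colour to each vertex so that no edge is monochromatic; the chromatic number is the minimum number of colours in a colouring. A triangle in an $r$-uniform hypergraph consists of three edges whose union is a set of exactly $r+1$ vertices; a hypergraph is triangle-free if it contains no triangle. *)

theory Defs
  imports Main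
begin

record 'a hypergraph =
  verts :: "'a set"
  edges :: "'a set set"

definition is_hypergraph :: "'a hypergraph \<Rightarrow> bool" where
  "is_hypergraph G \<longleftrightarrow> (\<forall>e\<in>edges G. e \<subseteq> verts G)"

definition uniform :: "nat \<Rightarrow> 'a hypergraph \<Rightarrow> bool" where
  "uniform r G \<longleftrightarrow> (\<forall>e\<in>edges G. finite e \<and> card e = r)"

definition subhypergraph :: "'a hypergraph \<Rightarrow> 'a hypergraph \<Rightarrow> bool" where
  "subhypergraph H G \<longleftrightarrow> is_hypergraph H \<and> verts H \<subseteq> verts G \<and> edges H \<subseteq> edges G"

text \<open>The degree is the intended one only when finitely many edges contain \<open>v\<close>
  (\<open>card\<close> is 0 on infinite sets); it is used for finite hypergraphs.\<close>

definition degree :: "'a hypergraph \<Rightarrow> 'a \<Rightarrow> nat" where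
  "degree G v = card {e \<in> edges G. v \<in> e}"

definition degenerate :: "nat \<Rightarrow> 'a hypergraph \<Rightarrow> bool" where
  "degenerate d G \<longleftrightarrow>
    (\<forall>H. subhypergraph H G \<and> verts H \<noteq> {} \<longrightarrow> (\<exists>v\<in>verts H. degree H v \<le> d))"

definition monochromatic :: "('a \<Rightarrow> 'c) \<Rightarrow> 'a set \<Rightarrow> bool" where
  "monochromatic c e \<longleftrightarrow> (\<exists>k. \<forall>v\<in>e. c v = k)"

definition colouring :: "'a hypergraph \<Rightarrow> ('a \<Rightarrow> 'c) \<Rightarrow> bool" where
  "colouring G c \<longleftrightarrow> (\<forall>e\<in>edges G. \<not> monochromatic c e)"

text \<open>The minimum is over a nonempty set for every finite hypergraph all of whose edges
  have at least two vertices, since an injective map is then a colouring.\<close>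

definition chromatic_number :: "'a hypergraph \<Rightarrow> nat" where
  "chromatic_number G =
    (LEAST k. \<exists>c :: 'a \<Rightarrow> nat. colouring G c \<and> c ` verts G \<subseteq> {..<k})"

text \<open>The three edges of a triangle are pairwise distinct: two edges sharing \<open>r - 1\<close>
  vertices already have a union of size \<open>r + 1\<close>.\<close>

definition triangle_free :: "nat \<Rightarrow> 'a hypergraph \<Rightarrow> bool" where
  "triangle_free r G \<longleftrightarrow>
    \<not> (\<exists>e\<^sub>1\<in>edges G. \<exists>e\<^sub>2\<in>edges G. \<exists>e\<^sub>3\<in>edges G.
        e\<^sub>1 \<noteq> e\<^sub>2 \<and> e\<^sub>1 \<noteq> e\<^sub>3 \<and> e\<^sub>2 \<noteq> e\<^sub>3 \<and> card (e\<^sub>1 \<union> e\<^sub>2 \<union> e\<^sub>3) = r + 1)"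

end

theory Submission imports Defs "HOL-Library.FuncSet" "HOL-Library.Nat_Bijection" begin

text \<open>Zykov-style induction on \<open>d\<close>. Given a hypergraph \<open>G\<close> for \<open>d\<close>, take disjoint copies of \<open>G\<close>
  indexed by pairs \<open>(i, j)\<close> with \<open>i \<le> d\<close> and \<open>j < r - 1\<close>, and for every choice \<open>\<phi>\<close> of one vertex
  in each copy add an apex lying in the \<open>d + 1\<close> edges that consist of the apex and the chosen
  vertices of the copies \<open>(i, j)\<close> with \<open>i\<close> fixed. In a colouring with \<open>d + 1\<close> colours every copy
  shows every colour, so some \<open>\<phi>\<close> picks colour \<open>i\<close> in all copies \<open>(i, j)\<close>, which leaves no
  colour for its apex. In a triangle any two edges meet and each edge is contained in the union of
  the other two, and this confines a triangle to a single copy.\<close>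

section \<open>Colourability and the chromatic number\<close>

definition colourable :: "nat \<Rightarrow> 'a hypergraph \<Rightarrow> bool" where
  "colourable k G \<longleftrightarrow> (\<exists>c :: 'a \<Rightarrow> nat. colouring G c \<and> c ` verts G \<subseteq> {..<k})"

lemma colourable_mono: "colourable k G \<Longrightarrow> k \<le> l \<Longrightarrow> colourable l G"
  unfolding colourable_def by (meson lessThan_subset_iff order_trans)

text \<open>Colourability is monotone in the number of colours, so failure at \<open>d\<close> rules
  out every smaller number as well.\<close>

lemma chromatic_number_eqI:
  assumes "colourable (Suc d) G" "\<not> colourable d G"
  shows "chromatic_number G = Suc d"
  unfolding chromatic_number_def colourable_def[symmetric]
proof (rule Least_equality)
  show "colourable (Suc d) G" by fact
  show "Suc d \<le> k" if "colourable k G" for k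
    using that assms(2) colourable_mono[of k G d] by (meson not_less_eq_eq)
qed

text \<open>If colour \<open>i\<close> were missing, colour \<open>d\<close> could be renamed to
  \<open>i\<close>. The renaming is injective on the colours in use, so it creates no monochromatic
  edge, and only \<open>d\<close> colours remain.\<close>

lemma all_colours_used:
  fixes c :: "'a \<Rightarrow> nat"
  assumes "is_hypergraph G" "colouring G c" "c ` verts G \<subseteq> {..<Suc d}" "\<not> colourable d G" "i < Suc d"
  shows "i \<in> c ` verts G"
proof (rule ccontr)
  assume i: "i \<notin> c ` verts G"
  define h where "h x = (if x = d then i else x)" for x
  have inj: "inj_on h (c ` verts G)"
    using i by (auto simp: inj_on_def h_def)
  have "colouring G (h \<circ> c)"
    unfolding colouring_def
  proof
    fix e assume e: "e \<in> edges G"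
    then have sub: "e \<subseteq> verts G" using assms(1) by (auto simp: is_hypergraph_def)
    show "\<not> monochromatic (h \<circ> c) e"
    proof
      assume "monochromatic (h \<circ> c) e"
      then have "c v = c w" if "v \<in> e" "w \<in> e" for v w
        using that sub inj unfolding monochromatic_def inj_on_def by (metis comp_apply imageI subsetD)
      then have "monochromatic c e" unfolding monochromatic_def by metis
      then show False using e assms(2) by (auto simp: colouring_def)
    qed
  qed
  moreover have "(h \<circ> c) ` verts G \<subseteq> {..<d}"
  proof
    fix x assume "x \<in> (h \<circ> c) ` verts G"
    then obtain v where v: "v \<in> verts G" "x = h (c v)" by auto
    have "c v < Suc d" "c v \<noteq> i" using v i assms(3) by auto
    then show "x \<in> {..<d}" using v assms(5) by (auto simp: h_def)
  qed
  ultimately show False using assms(4) unfolding colourable_def by blast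
qed

text \<open>Disjoint \<open>f\<close> and \<open>g\<close> would give 2r \<le> r + 1, against r
  \<ge> 2. Being distinct of size r, they have a union of at least r + 1 elements, which is all of
  the triangle.\<close>

lemma triangleD:
  assumes card: "card e = r" "card f = r" "card g = r" and "2 \<le> r" "f \<noteq> g"
    and un: "card (e \<union> f \<union> g) = r + 1"
  shows "f \<inter> g \<noteq> {}" "e \<subseteq> f \<union> g"
proof -
  have fin: "finite (e \<union> f \<union> g)" using un by (metis Suc_eq_plus1 Zero_not_Suc card.infinite)
  have "card (f \<union> g) \<le> r + 1" using card_mono[OF fin, of "f \<union> g"] un by auto
  then show "f \<inter> g \<noteq> {}" using card fin card_Un_disjoint[of f g] \<open>2 \<le> r\<close> by auto
  have "f \<subset> f \<union> g"
    using card fin \<open>f \<noteq> g\<close> card_seteq[of f g] by auto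
  then have "r < card (f \<union> g)" using fin card psubset_card_mono[of "f \<union> g" f] by auto
  then have "f \<union> g = e \<union> f \<union> g" using un by (intro card_seteq[OF fin]) auto
  then show "e \<subseteq> f \<union> g" by auto
qed

section \<open>The apex construction\<close>

text \<open>Vertices of the new hypergraph are given by abstract encodings with disjoint ranges, so
  that the induction can stay within one vertex type. Choices are extensional functions: only
  finitely many exist, and \<open>apex\<close> has to be injective on these alone.\<close>

locale apex_construction =
  fixes G :: "'a hypergraph" and r d :: nat
    and copy :: "nat \<times> nat \<Rightarrow> 'a \<Rightarrow> 'b" and apex :: "(nat \<times> nat \<Rightarrow> 'a) \<Rightarrow> 'b"
  assumes r: "2 \<le> r"
    and hyper: "is_hypergraph G" and fin: "finite (verts G)"
    and copy_eq_iff [simp]: "copy p v = copy q w \<longleftrightarrow> p = q \<and> v = w"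
    and inj_apex: "inj_on apex ({..d} \<times> {..<r - 1} \<rightarrow>\<^sub>E verts G)"
    and copy_neq_apex [simp]: "copy p v \<noteq> apex \<phi>"
begin

lemma apex_neq_copy [simp]: "apex \<phi> \<noteq> copy p v"
  using copy_neq_apex by metis

abbreviation "I \<equiv> {..d} \<times> {..<r - 1}"
abbreviation "\<Phi> \<equiv> I \<rightarrow>\<^sub>E verts G"

definition base :: "(nat \<times> nat \<Rightarrow> 'a) \<Rightarrow> nat \<Rightarrow> 'b set" where
  "base \<phi> i = (\<lambda>j. copy (i, j) (\<phi> (i, j))) ` {..<r - 1}"

definition spoke :: "(nat \<times> nat \<Rightarrow> 'a) \<Rightarrow> nat \<Rightarrow> 'b set" where
  "spoke \<phi> i = insert (apex \<phi>) (base \<phi> i)"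

definition ext :: "'b hypergraph" where
  "ext = \<lparr>verts = (\<Union>p\<in>I. copy p ` verts G) \<union> apex ` \<Phi>,
          edges = (\<Union>p\<in>I. (`) (copy p) ` edges G) \<union> (\<Union>\<phi>\<in>\<Phi>. spoke \<phi> ` {..d})\<rparr>"

lemma edge_cases:
  assumes "e \<in> edges ext"
  obtains (copy) p e' where "p \<in> I" "e' \<in> edges G" "e = copy p ` e'"
    | (spoke) \<phi> i where "\<phi> \<in> \<Phi>" "i \<le> d" "e = spoke \<phi> i"
  using assms unfolding ext_def by auto

lemma apex_eq_iff: "\<phi> \<in> \<Phi> \<Longrightarrow> \<psi> \<in> \<Phi> \<Longrightarrow> apex \<phi> = apex \<psi> \<longleftrightarrow> \<phi> = \<psi>"
  using inj_apex by (auto simp: inj_on_def)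

lemma apex_notin_base [simp]: "apex \<psi> \<notin> base \<phi> i"
  by (auto simp: base_def)

lemma base_nonempty: "base \<phi> i \<noteq> {}"
  using r by (simp add: base_def lessThan_empty_iff)

lemma inj_copy: "inj_on (copy p) A"
  by (auto simp: inj_on_def)

lemma base_subset:
  assumes "\<phi> \<in> \<Phi>" "i \<le> d"
  shows "base \<phi> i \<subseteq> (\<Union>p\<in>I. copy p ` verts G)"
proof
  fix x assume "x \<in> base \<phi> i"
  then obtain j where j: "j < r - 1" "x = copy (i, j) (\<phi> (i, j))" by (auto simp: base_def)
  then have "(i, j) \<in> I" using assms(2) by auto
  moreover from this have "\<phi> (i, j) \<in> verts G" by (rule PiE_mem[OF assms(1)])
  ultimately show "x \<in> (\<Union>p\<in>I. copy p ` verts G)" using j(2) by blast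
qed

lemma is_hypergraph_ext: "is_hypergraph ext"
  unfolding is_hypergraph_def
proof
  fix e assume "e \<in> edges ext"
  then show "e \<subseteq> verts ext"
  proof (cases rule: edge_cases)
    case (copy p e')
    then have "e' \<subseteq> verts G" using hyper by (auto simp: is_hypergraph_def)
    then show ?thesis using copy by (auto simp: ext_def)
  next
    case (spoke \<phi> i)
    then show ?thesis using base_subset[of \<phi> i] by (auto simp: ext_def spoke_def)
  qed
qed

lemma finite_ext: "finite (verts ext)"
  using fin by (auto simp: ext_def intro!: finite_PiE)

lemma uniform_ext:
  assumes "uniform r G"
  shows "uniform r ext"
  unfolding uniform_def
proof
  fix e assume "e \<in> edges ext"
  then show "finite e \<and> card e = r"
  proof (cases rule: edge_cases)
    case (copy p e')
    then show ?thesis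
      using assms card_image[OF inj_copy, of p e'] by (auto simp: uniform_def)
  next
    case (spoke \<phi> i)
    \<comment> \<open>The chosen vertices lie in different copies, hence are distinct.\<close>
    have "card (base \<phi> i) = r - 1" "finite (base \<phi> i)"
      unfolding base_def by (subst card_image) (auto simp: inj_on_def)
    then show ?thesis using spoke r by (simp add: spoke_def)
  qed
qed

section \<open>Triangle-freeness of the extension\<close>

lemma copies_meet:
  assumes "copy p ` e \<inter> copy q ` f \<noteq> {}" shows "p = q"
  using assms by auto

lemma spoke_meets_copy:
  assumes "spoke \<phi> i \<inter> copy p ` e \<noteq> {}" shows "i = fst p"
  using assms by (auto simp: spoke_def base_def)

text \<open>The apex of \<open>e\<close> lies in no copy, so it must lie in \<open>g\<close>, which
  is then a spoke with the same apex. Both spokes meet copy \<open>p\<close>, which forces both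
  indices to be \<open>fst p\<close>, so \<open>e = g\<close>.\<close>

lemma no_mixed_triangle:
  assumes e: "\<phi> \<in> \<Phi>" "e = spoke \<phi> i" and f: "f = copy p ` f'" and g: "g \<in> edges ext" "e \<noteq> g"
    and "e \<inter> f \<noteq> {}" "f \<inter> g \<noteq> {}" "e \<subseteq> f \<union> g"
  shows False
proof -
  have a: "apex \<phi> \<in> g" using assms by (auto simp: spoke_def)
  from g(1) show False
  proof (cases rule: edge_cases)
    case (copy q g')
    then show False using a by auto
  next
    case (spoke \<psi> j)
    then have "\<psi> = \<phi>" using a e(1) apex_eq_iff by (auto simp: spoke_def)
    moreover have "i = fst p" "j = fst p"
      using assms(6,7) spoke_meets_copy unfolding e f spoke by (metis inf_commute)+
    ultimately show False using e g spoke by simp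
  qed
qed

lemma spoke_apex_in:
  assumes "\<phi> \<in> \<Phi>" "\<psi> \<in> \<Phi>" "\<chi> \<in> \<Phi>" "spoke \<phi> i \<subseteq> spoke \<psi> j \<union> spoke \<chi> k"
  shows "\<phi> = \<psi> \<or> \<phi> = \<chi>"
  using assms apex_eq_iff by (auto simp: spoke_def)

lemma no_spoke_triangle:
  assumes "\<phi> \<in> \<Phi>" "\<psi> \<in> \<Phi>" "\<chi> \<in> \<Phi>"
    and "e = spoke \<phi> i" "f = spoke \<psi> j" "g = spoke \<chi> k"
    and "e \<noteq> f" "e \<noteq> g" "f \<noteq> g"
    and "e \<subseteq> f \<union> g" "f \<subseteq> e \<union> g" "g \<subseteq> e \<union> f"
  shows False
proof -
  \<comment> \<open>Each apex lies in one of the other two spokes, so each choice equals one of the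
    other two and all three coincide.\<close>
  have eq: "\<psi> = \<phi>" "\<chi> = \<phi>"
    using assms spoke_apex_in[of \<phi> \<psi> \<chi> i j k] spoke_apex_in[of \<psi> \<phi> \<chi> j i k]
      spoke_apex_in[of \<chi> \<phi> \<psi> k i j] by blast+
  then have "i \<noteq> j" "i \<noteq> k" using assms by auto
  \<comment> \<open>Spokes of one choice with different indices use disjoint groups of copies, so
    they share only the apex.\<close>
  then have "base \<phi> i \<inter> (base \<phi> j \<union> base \<phi> k) = {}" by (auto simp: base_def)
  moreover have "base \<phi> i \<subseteq> base \<phi> j \<union> base \<phi> k"
    using assms(4-6,10) eq apex_notin_base[of \<phi> \<phi> i] by (auto simp: spoke_def)
  ultimately show False using base_nonempty by blast
qed

lemma triangle_free_ext:
  assumes unif: "uniform r G" and tf: "triangle_free r G"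
  shows "triangle_free r ext"
  unfolding triangle_free_def
proof clarify
  fix e f g
  assume mem: "e \<in> edges ext" "f \<in> edges ext" "g \<in> edges ext"
    and ne: "e \<noteq> f" "e \<noteq> g" "f \<noteq> g" and un: "card (e \<union> f \<union> g) = r + 1"
  have c: "card e = r" "card f = r" "card g = r"
    using uniform_ext[OF unif] mem by (auto simp: uniform_def)
  have un': "card (f \<union> e \<union> g) = r + 1" "card (g \<union> e \<union> f) = r + 1"
    using un by (simp_all add: Un_ac)
  note e = triangleD[OF c(1,2,3) r ne(3) un]
  note f = triangleD[OF c(2,1,3) r ne(2) un'(1)]
  note g = triangleD[OF c(3,1,2) r ne(1) un'(2)]
  have meet: "e \<inter> f \<noteq> {}" "f \<inter> e \<noteq> {}" "e \<inter> g \<noteq> {}" "g \<inter> e \<noteq> {}" "f \<inter> g \<noteq> {}" "g \<inter> f \<noteq> {}"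
    using e(1) f(1) g(1) by blast+
  from mem(1) show False
  proof (cases rule: edge_cases)
    case 1: (copy p e')
    from mem(2) show False
    proof (cases rule: edge_cases)
      case 2: (copy q f')
      from mem(3) show False
      proof (cases rule: edge_cases)
        case 3: (copy s g')
        \<comment> \<open>Copied edges that meet come from the same copy; since
          \<open>copy p\<close> is injective, the triangle pulls back to \<open>G\<close>.\<close>
        have "q = p" "s = p" using meet(2,4) copies_meet unfolding 1(3) 2(3) 3(3) by blast+
        then have "e \<union> f \<union> g = copy p ` (e' \<union> f' \<union> g')" using 1 2 3 by auto
        then have "card (e' \<union> f' \<union> g') = r + 1" using un card_image[OF inj_copy] by metis
        moreover have "e' \<noteq> f'" "e' \<noteq> g'" "f' \<noteq> g'" using ne 1 2 3 \<open>q = p\<close> \<open>s = p\<close> by auto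
        ultimately show False using tf 1(2) 2(2) 3(2) by (auto simp: triangle_free_def)
      next
        case (spoke \<phi> i)
        then show False using no_mixed_triangle[OF spoke(1,3) 1(3) mem(2) ne(3)[symmetric] meet(4,1) g(2)] by simp
      qed
    next
      case (spoke \<phi> i)
      then show False using no_mixed_triangle[OF spoke(1,3) 1(3) mem(3) ne(3) meet(2,3) f(2)] by simp
    qed
  next
    case 1: (spoke \<phi> i)
    from mem(2) show False
    proof (cases rule: edge_cases)
      case (copy p f')
      then show False using no_mixed_triangle[OF 1(1,3) copy(3) mem(3) ne(2) meet(1,5) e(2)] by simp
    next
      case 2: (spoke \<psi> j)
      from mem(3) show False
      proof (cases rule: edge_cases)
        case (copy p g')
        then show False using no_mixed_triangle[OF 1(1,3) copy(3) mem(2) ne(1) meet(3,6)] e(2) by auto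
      next
        case 3: (spoke \<chi> k)
        then show False
          using no_spoke_triangle[OF 1(1) 2(1) 3(1) 1(3) 2(3) 3(3) ne e(2) f(2) g(2)] by simp
      qed
    qed
  qed
qed

section \<open>Degeneracy of the extension\<close>

text \<open>An apex lies only in its own d + 1 spokes, so any apex in \<open>H\<close> has small
  degree. Without apexes \<open>H\<close> lives inside the copies, and degeneracy of
  \<open>G\<close> applies to one copy that it meets.\<close>

lemma degenerate_ext:
  assumes deg: "degenerate d G"
  shows "degenerate (Suc d) ext"
  unfolding degenerate_def
proof clarify
  fix H assume sub: "subhypergraph H ext" and ne: "verts H \<noteq> {}"
  show "\<exists>v\<in>verts H. degree H v \<le> Suc d"
  proof (cases "\<exists>\<phi>\<in>\<Phi>. apex \<phi> \<in> verts H")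
    case True
    then obtain \<phi> where \<phi>: "\<phi> \<in> \<Phi>" "apex \<phi> \<in> verts H" by blast
    have "{e \<in> edges H. apex \<phi> \<in> e} \<subseteq> spoke \<phi> ` {..d}"
    proof clarify
      fix e assume e: "e \<in> edges H" "apex \<phi> \<in> e"
      then have "e \<in> edges ext" using sub by (auto simp: subhypergraph_def)
      then show "e \<in> spoke \<phi> ` {..d}"
        using e(2) \<phi>(1) apex_eq_iff by (cases rule: edge_cases) (auto simp: spoke_def)
    qed
    then have "degree H (apex \<phi>) \<le> card (spoke \<phi> ` {..d})"
      unfolding degree_def by (intro card_mono) auto
    also have "\<dots> \<le> Suc d" using card_image_le[of "{..d}" "spoke \<phi>"] by simp
    finally show ?thesis using \<phi> by blast
  next
    case no_apex: False
    with ne sub obtain p v where pv: "p \<in> I" "v \<in> verts G" "copy p v \<in> verts H"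
      by (force simp: subhypergraph_def ext_def)
    \<comment> \<open>The part of \<open>H\<close> inside copy \<open>p\<close>, pulled back to
      \<open>G\<close>.\<close>
    define K where "K = \<lparr>verts = {v \<in> verts G. copy p v \<in> verts H},
                         edges = {e \<in> edges G. copy p ` e \<in> edges H}\<rparr>"
    have "copy p v \<in> verts H" if "copy p ` e \<in> edges H" "v \<in> e" for e v
      using sub that unfolding subhypergraph_def is_hypergraph_def by blast
    then have "subhypergraph K G"
      using hyper by (auto simp: subhypergraph_def is_hypergraph_def K_def)
    moreover have "verts K \<noteq> {}" using pv by (auto simp: K_def)
    ultimately obtain w where w: "w \<in> verts K" "degree K w \<le> d"
      using deg by (auto simp: degenerate_def)
    \<comment> \<open>A spoke would bring its apex into \<open>H\<close>, and an edge from another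
      copy misses \<open>copy p w\<close>.\<close>
    have "{e \<in> edges H. copy p w \<in> e} \<subseteq> (`) (copy p) ` {e \<in> edges K. w \<in> e}"
    proof clarify
      fix e assume e: "e \<in> edges H" "copy p w \<in> e"
      then have "e \<in> edges ext" "e \<subseteq> verts H"
        using sub by (auto simp: subhypergraph_def is_hypergraph_def)
      from this(1) show "e \<in> (`) (copy p) ` {e \<in> edges K. w \<in> e}"
      proof (cases rule: edge_cases)
        case (copy q e')
        then show ?thesis using e by (auto simp: K_def)
      next
        case (spoke \<phi> i)
        then show ?thesis using no_apex \<open>e \<subseteq> verts H\<close> by (auto simp: spoke_def)
      qed
    qed
    moreover have "finite (edges K)"
      using fin hyper by (intro finite_subset[of "edges K" "Pow (verts G)"])
        (auto simp: K_def is_hypergraph_def)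
    ultimately have "degree H (copy p w) \<le> degree K w"
      unfolding degree_def by (intro surj_card_le) auto
    then show ?thesis using w by (intro bexI[of _ "copy p w"]) (auto simp: K_def)
  qed
qed

section \<open>Colourings of the extension\<close>

lemma colourable_ext:
  assumes "colourable (Suc d) G"
  shows "colourable (Suc (Suc d)) ext"
proof -
  obtain c :: "'a \<Rightarrow> nat" where c: "colouring G c" "c ` verts G \<subseteq> {..<Suc d}"
    using assms by (auto simp: colourable_def)
  \<comment> \<open>Every copy keeps the colouring \<open>c\<close>, and all apexes get the fresh
    colour \<open>Suc d\<close>. The description operator decodes the unique
    \<open>v\<close>.\<close>
  define c' where "c' x = (if \<exists>p v. x = copy p v then c (THE v. \<exists>p. x = copy p v) else Suc d)" for x
  have c' [simp]: "c' (copy p v) = c v" "c' (apex \<phi>) = Suc d" for p v \<phi>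
    by (auto simp: c'_def)
  have "colouring ext c'"
    unfolding colouring_def
  proof
    fix e assume "e \<in> edges ext"
    then show "\<not> monochromatic c' e"
    proof (cases rule: edge_cases)
      case (copy p e')
      then show ?thesis using c(1) by (auto simp: colouring_def monochromatic_def)
    next
      case (spoke \<phi> i)
      \<comment> \<open>Index 0 is available because r - 1 > 0; this vertex has an old colour,
        unlike the apex.\<close>
      have "copy (i, 0) (\<phi> (i, 0)) \<in> e" "apex \<phi> \<in> e"
        using spoke r by (auto simp: spoke_def base_def)
      moreover have "\<phi> (i, 0) \<in> verts G"
        using spoke r by (intro PiE_mem[of \<phi> I]) auto
      then have "c (\<phi> (i, 0)) < Suc d" using c(2) by auto
      ultimately show ?thesis
        unfolding monochromatic_def by (metis c' less_irrefl)
    qed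
  qed
  moreover have "c' ` verts ext \<subseteq> {..<Suc (Suc d)}"
    using c(2) by (auto simp: ext_def less_Suc_eq)
  ultimately show ?thesis by (auto simp: colourable_def)
qed

lemma not_colourable_ext:
  assumes "\<not> colourable d G"
  shows "\<not> colourable (Suc d) ext"
proof
  assume "colourable (Suc d) ext"
  then obtain c :: "'b \<Rightarrow> nat" where c: "colouring ext c" "c ` verts ext \<subseteq> {..<Suc d}"
    by (auto simp: colourable_def)
  \<comment> \<open>On each copy \<open>c\<close> induces a colouring of \<open>G\<close>, which
    shows all d + 1 colours, in particular \<open>fst p\<close>.\<close>
  have "\<exists>v\<in>verts G. c (copy p v) = fst p" if "p \<in> I" for p
  proof -
    have "colouring G (c \<circ> copy p)"
      unfolding colouring_def
    proof
      fix e assume "e \<in> edges G"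
      then have "copy p ` e \<in> edges ext" using that by (auto simp: ext_def)
      then show "\<not> monochromatic (c \<circ> copy p) e"
        using c(1) by (auto simp: colouring_def monochromatic_def)
    qed
    moreover have "(c \<circ> copy p) ` verts G \<subseteq> {..<Suc d}"
      using c(2) that by (fastforce simp: ext_def)
    ultimately have "fst p \<in> (c \<circ> copy p) ` verts G"
      using that hyper assms by (intro all_colours_used) auto
    then show ?thesis by auto
  qed
  then obtain h where h: "\<And>p. p \<in> I \<Longrightarrow> h p \<in> verts G \<and> c (copy p (h p)) = fst p"
    by metis
  define \<phi> where "\<phi> = restrict h I"
  \<comment> \<open>The index of the bad spoke is the colour of its own apex.\<close>
  define i where "i = c (apex \<phi>)"
  have \<phi>: "\<phi> \<in> \<Phi>" using h by (auto simp: \<phi>_def)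
  then have "apex \<phi> \<in> verts ext" by (simp add: ext_def)
  then have "c (apex \<phi>) < Suc d" using c(2) by blast
  then have i: "i \<le> d" by (simp add: i_def)
  have "c (copy (i, j) (\<phi> (i, j))) = i" if "j < r - 1" for j
    using h[of "(i, j)"] i that by (auto simp: \<phi>_def)
  then have "monochromatic c (spoke \<phi> i)"
    unfolding monochromatic_def by (intro exI[of _ i]) (auto simp: spoke_def base_def i_def)
  moreover have "spoke \<phi> i \<in> edges ext" using \<phi> i by (auto simp: ext_def)
  ultimately show False using c(1) by (auto simp: colouring_def)
qed

end

section \<open>Induction on the number of colours\<close>

lemma ex_triangle_free_degenerate:
  fixes r d :: nat
  assumes "2 \<le> r"
  shows "\<exists>G :: nat hypergraph. is_hypergraph G \<and> finite (verts G) \<and> uniform r G \<and>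
    triangle_free r G \<and> degenerate d G \<and> colourable (Suc d) G \<and> \<not> colourable d G"
proof (induction d)
  case 0
  \<comment> \<open>A single vertex without edges needs one colour, since the empty palette cannot
    colour it.\<close>
  define G :: "nat hypergraph" where "G = \<lparr>verts = {0}, edges = {}\<rparr>"
  have "degenerate 0 G"
    by (auto simp: degenerate_def subhypergraph_def degree_def G_def)
  moreover have "colourable (Suc 0) G"
    unfolding colourable_def by (intro exI[of _ "\<lambda>_. 0"]) (auto simp: colouring_def G_def)
  moreover have "\<not> colourable 0 G" by (auto simp: colourable_def G_def)
  ultimately show ?case
    by (intro exI[of _ G]) (auto simp: is_hypergraph_def uniform_def triangle_free_def G_def)
next
  case (Suc d)
  then obtain G :: "nat hypergraph" where G: "is_hypergraph G" "finite (verts G)" "uniform r G"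
    "triangle_free r G" "degenerate d G" "colourable (Suc d) G" "\<not> colourable d G"
    by blast
  have "finite ({..d} \<times> {..<r - 1} \<rightarrow>\<^sub>E verts G)" using G(2) by (intro finite_PiE) auto
  then obtain g :: "(nat \<times> nat \<Rightarrow> nat) \<Rightarrow> nat" where g: "inj_on g ({..d} \<times> {..<r - 1} \<rightarrow>\<^sub>E verts G)"
    using finite_imp_inj_to_nat_seg by blast
  \<comment> \<open>Even numbers encode the copies and odd numbers the apexes.\<close>
  interpret apex_construction G r d "\<lambda>p v. 2 * prod_encode (prod_encode p, v)" "\<lambda>\<phi>. Suc (2 * g \<phi>)"
  proof
    show "2 * prod_encode (prod_encode p, v) \<noteq> Suc (2 * g \<phi>)" for p v \<phi>
      by presburger
  qed (use assms G g in \<open>auto simp: inj_on_def\<close>)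
  show ?case
    using is_hypergraph_ext finite_ext uniform_ext triangle_free_ext degenerate_ext
      colourable_ext not_colourable_ext G by blast
qed

theorem theorem3:
  fixes r d :: nat
  assumes "r \<ge> 2" and "d \<ge> 1"
  shows "\<exists>G :: nat hypergraph. is_hypergraph G \<and> finite (verts G) \<and> uniform r G \<and>
           triangle_free r G \<and> degenerate d G \<and> chromatic_number G = d + 1"
  using ex_triangle_free_degenerate[OF assms(1), of d] chromatic_number_eqI by fastforce

end
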